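(* Let $f$ be a continuous map on a compact, metrizable space $X$ such that $f^{-1}(|f|)=|f|$ and let $K=X\setminus|f|^\circ$. Then $\mathcal Wf=1_{|f|}\cup\mathcal C(f|K)$. Hence, $|\mathcal Wf|=|f|\cup|\mathcal C(f|K)|$.
   Context: A relation on $X$ is a subset of $X\times X$ and a map is identified with its graph. $|F|=\{x:(x,x)\in F\}$, so $|f|$ is the set of fixed points of $f$, and $|f|^\circ$ is its interior. $1_A=\{(x,x):x\in A\}$. $f|K=f\cap(K\times K)$. For a relation $g$ on $X$, $\mathcal Cg$ is the set of $(x,y)$ such that for some (equivalently, every) metric $d$ compatible with the topology and every $\epsilon>0$ there are $n\ge1$ and $(a_1,b_1),\dots,(a_n,b_n)\in g$ with $\max(d(x,a_1),d(b_1,a_2),\dots,d(b_{n-1},a_n),d(b_n,y))<\epsilon$. For a neighborhood $V$ of $1_X$ in $X\times X$ and $x,y\in X$, an $xy,V$ chain of length $n$ (for $f$) is a sequence $(a_1,b_1),\dots,(a_n,b_n)\in f$, $n\ge1$, such that $(x,a_1)$, $(b_n,y)$ and $(b_i,a_{i+1})$ for $i=1,\dots,n-1$ all lie in $V$. $\mathcal Wf$ is the set of pairs $(x,y)$ such that for every neighborhood $W$ of $1_X$ there exist a closed, symmetric neighborhood $V$ of $1_X$ and $n\in\mathbb N=\{1,2,\dots\}$ such that there is an $xy,V$ chain of length $n$ and $V^{3^n}\subset W$, where $V^m$ is the $m$-fold composition of $V$ with itself. *)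

theory Defs
  imports "HOL-Analysis.Analysis"
begin

definition graph_on :: "'a topology \<Rightarrow> ('a \<Rightarrow> 'a) \<Rightarrow> 'a rel" where
  "graph_on X f = {(x, f x) | x. x \<in> topspace X}"

text \<open>The set written $|F|$ in the source: the points related to themselves.\<close>
definition fixed_set :: "'a rel \<Rightarrow> 'a set" where
  "fixed_set F = {x. (x, x) \<in> F}"

definition diag_nhd :: "'a topology \<Rightarrow> 'a rel \<Rightarrow> bool" where
  "diag_nhd X V \<longleftrightarrow> V \<subseteq> topspace X \<times> topspace X \<and>
     (\<exists>U. openin (prod_topology X X) U \<and> Id_on (topspace X) \<subseteq> U \<and> U \<subseteq> V)"

text \<open>
  The list \<open>ps\<close> is \<open>(a\<^sub>1, b\<^sub>1), \<dots>, (a\<^sub>n, b\<^sub>n)\<close>, with \<open>n = length ps\<close>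
  and indices shifted to start at 0.
\<close>
definition chain :: "'a rel \<Rightarrow> 'a rel \<Rightarrow> 'a \<Rightarrow> 'a \<Rightarrow> ('a \<times> 'a) list \<Rightarrow> bool" where
  "chain g V x y ps \<longleftrightarrow> ps \<noteq> [] \<and> set ps \<subseteq> g \<and>
     (x, fst (hd ps)) \<in> V \<and> (snd (last ps), y) \<in> V \<and>
     (\<forall>i. Suc i < length ps \<longrightarrow> (snd (ps ! i), fst (ps ! Suc i)) \<in> V)"

definition compatible_metric :: "'a topology \<Rightarrow> ('a \<Rightarrow> 'a \<Rightarrow> real) \<Rightarrow> bool" where
  "compatible_metric X d \<longleftrightarrow>
     Metric_space (topspace X) d \<and> Metric_space.mtopology (topspace X) d = X"

definition metric_chain_rel :: "'a topology \<Rightarrow> ('a \<Rightarrow> 'a \<Rightarrow> real) \<Rightarrow> 'a rel \<Rightarrow> 'a rel" where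
  "metric_chain_rel X d g = {(x, y) \<in> topspace X \<times> topspace X. \<forall>\<epsilon>>0. \<exists>ps. chain g {(a, b). d a b < \<epsilon>} x y ps}"

text \<open>
  The chain relation \<open>\<C>g\<close> of a relation \<open>g\<close> on \<open>X\<close>. The choice of a compatible metric is
  immaterial on a compact metrizable space; see \<open>chain_rel_eq\<close> below.
\<close>
definition chain_rel :: "'a topology \<Rightarrow> 'a rel \<Rightarrow> 'a rel" where
  "chain_rel X g = {(x, y). \<exists>d. compatible_metric X d \<and> (x, y) \<in> metric_chain_rel X d g}"

text \<open>The relation \<open>\<W>f\<close>, where \<open>g\<close> is the graph of \<open>f\<close>.\<close>
definition W_rel :: "'a topology \<Rightarrow> 'a rel \<Rightarrow> 'a rel" where
  "W_rel X g = {(x, y) \<in> topspace X \<times> topspace X.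
     \<forall>W. diag_nhd X W \<longrightarrow>
       (\<exists>V n. diag_nhd X V \<and> closedin (prod_topology X X) V \<and> sym V \<and> n \<ge> 1 \<and>
          (\<exists>ps. chain g V x y ps \<and> length ps = n) \<and> V ^^ (3 ^ n) \<subseteq> W)}"

lemma chain_mono:
  assumes "chain g V x y ps"
    and "\<And>a b. a \<in> insert x (snd ` g) \<Longrightarrow> b \<in> insert y (fst ` g) \<Longrightarrow> (a, b) \<in> V \<Longrightarrow> (a, b) \<in> V'"
  shows "chain g V' x y ps"
proof -
  from assms(1) have ne: "ps \<noteq> []" and sub: "set ps \<subseteq> g" by (auto simp: chain_def)
  have "fst (hd ps) \<in> fst ` g" "snd (last ps) \<in> snd ` g"
    using ne sub by (meson hd_in_set last_in_set imageI subsetD)+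
  moreover have "snd (ps ! i) \<in> snd ` g" "fst (ps ! Suc i) \<in> fst ` g" if "Suc i < length ps" for i
    using that sub by (meson Suc_lessD imageI nth_mem subsetD)+
  ultimately show ?thesis
    using assms unfolding chain_def by simp
qed

lemma metric_chain_rel_le:
  assumes "compact_space X" "compatible_metric X d" "compatible_metric X d'"
    and g: "g \<subseteq> topspace X \<times> topspace X"
  shows "metric_chain_rel X d g \<subseteq> metric_chain_rel X d' g"
proof -
  interpret A: Metric_space "topspace X" d using assms by (simp add: compatible_metric_def)
  interpret B: Metric_space "topspace X" d' using assms by (simp add: compatible_metric_def)
  have A: "A.mtopology = X" and B: "B.mtopology = X"
    using assms(2,3) by (simp_all add: compatible_metric_def)
  have "uniformly_continuous_map (metric (topspace X, d)) (metric (topspace X, d')) id"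
    by (rule continuous_imp_uniformly_continuous_map)
      (simp only: A.mtopology_of B.mtopology_of A B assms(1) continuous_map_id simp_thms)
  then have U: "\<exists>\<delta>>0. \<forall>a\<in>topspace X. \<forall>b\<in>topspace X. d a b < \<delta> \<longrightarrow> d' a b < \<epsilon>" if "\<epsilon> > 0" for \<epsilon>
    using that unfolding uniformly_continuous_map_def A.mspace_metric A.mdist_metric
        B.mdist_metric id_apply by blast
  show ?thesis
  proof (clarsimp simp: metric_chain_rel_def)
    fix x y and \<epsilon> :: real
    assume xy: "x \<in> topspace X" "y \<in> topspace X" and "\<epsilon> > 0"
      and ch: "\<forall>\<epsilon>>0. \<exists>ps. chain g {(a, b). d a b < \<epsilon>} x y ps"
    obtain \<delta> where "\<delta> > 0" and \<delta>: "\<forall>a\<in>topspace X. \<forall>b\<in>topspace X. d a b < \<delta> \<longrightarrow> d' a b < \<epsilon>"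
      using U[OF \<open>\<epsilon> > 0\<close>] by blast
    obtain ps where "chain g {(a, b). d a b < \<delta>} x y ps" using ch \<open>\<delta> > 0\<close> by blast
    then have "chain g {(a, b). d' a b < \<epsilon>} x y ps"
      by (rule chain_mono) (use \<delta> g xy in fastforce)
    then show "\<exists>ps. chain g {(a, b). d' a b < \<epsilon>} x y ps" ..
  qed
qed

lemma chain_rel_eq:
  assumes "compact_space X" "compatible_metric X d" "g \<subseteq> topspace X \<times> topspace X"
  shows "chain_rel X g = metric_chain_rel X d g"
  using metric_chain_rel_le assms unfolding chain_rel_def by blast

end

theory Submission
  imports Defs
begin

text \<open>
  For \<open>W_rel X F \<subseteq> \<dots>\<close>, delete the fixed points from a \<open>V\<close>-chain of length \<open>n\<close>: each remaining jump
  is a composition of at most \<open>n + 1 \<le> 3 ^ n\<close> jumps of \<open>V\<close>, hence small, and the hypothesis on \<open>f\<close>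
  keeps the non-fixed points in \<open>K\<close>. If nothing remains, \<open>x\<close> and \<open>y\<close> are arbitrarily close to each other
  and to fixed points.

  For the converse, \<open>K\<close> is the closure of the non-fixed points, so an \<open>\<epsilon>\<close>-chain in \<open>K\<close> may be perturbed
  to visit non-fixed points only. If the jumps of a chain were pairwise disjoint, a neighborhood \<open>V\<close> made of
  these finitely many jumps and a very thin neighborhood of the diagonal would have small iterates, whatever
  the length of the chain. A chain with disjoint jumps is extracted by following the given one: when
  the next jump would meet an earlier one, the path is either cut at that place or the jump is postponed
  by one application of \<open>f\<close>, which costs only the modulus of continuity of \<open>f\<close> once and never accumulates.
\<close>

section \<open>Paths of a map and disjointness of their jumps\<close>

text \<open>A chain in the graph of \<open>f\<close> is determined by its departure points
  \<open>a 0, a 1, ...\<close>. Counting the start \<open>x\<close> as arrival 0 gives every jump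
  the same form, from \<open>arrival f x a i\<close> to \<open>a i\<close>, and leaves a final jump
  from \<open>arrival f x a n\<close> into the target.\<close>

definition arrival :: "('a \<Rightarrow> 'a) \<Rightarrow> 'a \<Rightarrow> (nat \<Rightarrow> 'a) \<Rightarrow> nat \<Rightarrow> 'a" where
  "arrival f x a n = (case n of 0 \<Rightarrow> x | Suc i \<Rightarrow> f (a i))"

lemma arrival_simps [simp]: "arrival f x a 0 = x" "arrival f x a (Suc i) = f (a i)"
  by (simp_all add: arrival_def)

lemma arrival_cong: "(\<And>i. i < n \<Longrightarrow> a i = b i) \<Longrightarrow> arrival f x a n = arrival f x b n"
  by (cases n) simp_all

lemma arrival_upd [simp]: "i \<le> n \<Longrightarrow> arrival f x (a(n := \<alpha>)) i = arrival f x a i"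
  by (rule arrival_cong) auto

lemma chain_graph_on_iff:
  assumes "n > 0"
  shows "chain (graph_on X f) V x y (map (\<lambda>i. (a i, f (a i))) [0..<n]) \<longleftrightarrow>
    (\<forall>i<n. a i \<in> topspace X \<and> (arrival f x a i, a i) \<in> V) \<and> (arrival f x a n, y) \<in> V"
    (is "chain _ _ _ _ ?ps \<longleftrightarrow> ?R")
proof -
  obtain m where n: "n = Suc m" using assms gr0_conv_Suc by blast
  have "(\<forall>i. Suc i < n \<longrightarrow> (f (a i), a (Suc i)) \<in> V) \<and> (x, a 0) \<in> V \<longleftrightarrow>
      (\<forall>i<n. (arrival f x a i, a i) \<in> V)"
    by (auto simp: n All_less_Suc2)
  moreover have "set ?ps \<subseteq> graph_on X f \<longleftrightarrow> (\<forall>i<n. a i \<in> topspace X)"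
    by (auto simp: graph_on_def image_subset_iff)
  moreover have "hd ?ps = (a 0, f (a 0))" "last ?ps = (a m, f (a m))"
    using n by (simp_all add: hd_map last_map del: upt_Suc)
  moreover have "(\<forall>i. Suc i < length ?ps \<longrightarrow> (snd (?ps ! i), fst (?ps ! Suc i)) \<in> V) \<longleftrightarrow>
     (\<forall>i. Suc i < n \<longrightarrow> (f (a i), a (Suc i)) \<in> V)"
    by (simp del: upt_Suc)
  moreover have "?ps \<noteq> []" "arrival f x a n = f (a m)" using n by simp_all
  ultimately show ?thesis
    unfolding chain_def by auto
qed

lemma chain_graph_on_obtain:
  assumes "chain (graph_on X f) V x y ps"
  obtains a n where "n > 0" "ps = map (\<lambda>i. (a i, f (a i))) [0..<n]"
proof
  have "ps ! i \<in> graph_on X f" if "i < length ps" for i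
    using assms that by (meson chain_def nth_mem subsetD)
  then show "ps = map (\<lambda>i. (fst (ps ! i), f (fst (ps ! i)))) [0..<length ps]"
    by (intro nth_equalityI) (fastforce simp: graph_on_def)+
  show "length ps > 0" using assms by (simp add: chain_def)
qed

text \<open>
  The jumps \<open>{arrival f x a i, a i}\<close> with \<open>i < n\<close> are small and pairwise disjoint, where a jump may consist
  of a single point; the point \<open>arrival f x a n\<close> is where the path ends. Paths are cut by decreasing \<open>n\<close>.
\<close>
definition matched :: "('a \<Rightarrow> 'a \<Rightarrow> real) \<Rightarrow> ('a \<Rightarrow> 'a) \<Rightarrow> 'a set \<Rightarrow> real \<Rightarrow> 'a \<Rightarrow> (nat \<Rightarrow> 'a) \<Rightarrow> nat \<Rightarrow> bool" where
  "matched d f A \<eta> x a n \<longleftrightarrow>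
     (\<forall>i<n. a i \<in> A \<and> d (arrival f x a i) (a i) < \<eta>) \<and>
     inj_on (arrival f x a) {..<n} \<and> inj_on a {..<n} \<and>
     (\<forall>i<n. \<forall>j<n. a i = arrival f x a j \<longrightarrow> i = j)"

definition fresh :: "('a \<Rightarrow> 'a) \<Rightarrow> 'a \<Rightarrow> (nat \<Rightarrow> 'a) \<Rightarrow> nat \<Rightarrow> 'a \<Rightarrow> bool" where
  "fresh f x a n p \<longleftrightarrow> (\<forall>i<n. p \<noteq> a i \<and> p \<noteq> arrival f x a i)"

lemma matched_truncate:
  assumes "matched d f A \<eta> x a n" "k < n"
  shows "matched d f A \<eta> x a k"
  using assms unfolding matched_def by (auto intro: inj_on_subset)

text \<open>Jump \<open>k\<close> is disjoint from the earlier ones, so a path cut just before it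
  ends outside all the jumps that are kept. Hence cutting never destroys freshness of the
  end.\<close>

lemma matched_fresh:
  assumes "matched d f A \<eta> x a n" "k < n"
  shows "fresh f x a k (arrival f x a k)"
proof -
  have "arrival f x a k \<noteq> a i \<and> arrival f x a k \<noteq> arrival f x a i" if "i < k" for i
    using assms that less_trans[of i k n] unfolding matched_def inj_on_def
    by (metis lessThan_iff less_irrefl)
  then show ?thesis by (simp add: fresh_def)
qed

text \<open>Both points of the new jump avoid all earlier jumps. They may coincide, since a jump may
  consist of a single point.\<close>

lemma matched_extend:
  assumes m: "matched d f A \<eta> x a n" and fr: "fresh f x a n (arrival f x a n)" "fresh f x a n \<alpha>"
    and \<alpha>: "\<alpha> \<in> A" "d (arrival f x a n) \<alpha> < \<eta>"
  shows "matched d f A \<eta> x (a(n := \<alpha>)) (Suc n)"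
proof -
  let ?b = "a(n := \<alpha>)"
  have arr: "arrival f x ?b i = arrival f x a i" if "i < Suc n" for i
    using that by simp
  have "inj_on (arrival f x ?b) {..<Suc n}"
  proof -
    have "inj_on (arrival f x a) {..<Suc n}"
      using m fr by (auto simp: matched_def fresh_def lessThan_Suc)
    then show ?thesis using arr by (simp add: inj_on_def)
  qed
  moreover have "inj_on ?b {..<Suc n}"
    using m fr unfolding matched_def fresh_def inj_on_def by (auto simp: less_Suc_eq)
  moreover have "i = j" if "i < Suc n" "j < Suc n" "?b i = arrival f x ?b j" for i j
    using m fr that arr[of j] unfolding matched_def fresh_def by (auto simp: less_Suc_eq split: if_splits)
  moreover have "?b i \<in> A \<and> d (arrival f x ?b i) (?b i) < \<eta>" if "i < Suc n" for i
    using m \<alpha> that arr[of i] unfolding matched_def by (auto simp: less_Suc_eq)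
  ultimately show ?thesis unfolding matched_def by blast
qed

section \<open>Iterates of a relation and deletion of fixed points from a chain\<close>

lemma relpow_subset_Times:
  assumes "R \<subseteq> A \<times> A" "m > 0"
  shows "R ^^ m \<subseteq> A \<times> A"
proof clarify
  fix u v assume uv: "(u, v) \<in> R ^^ m"
  obtain k where "m = Suc k" using \<open>m > 0\<close> gr0_conv_Suc by blast
  with uv have uv: "(u, v) \<in> R ^^ Suc k" by simp
  from uv have "u \<in> A" by (rule relpow_Suc_E2) (use assms in blast)
  moreover from uv have "v \<in> A" by (rule relpow_Suc_E) (use assms in blast)
  ultimately show "u \<in> A \<and> v \<in> A" ..
qed

lemma metric_chain_rel_mono:
  assumes "g \<subseteq> h"
  shows "metric_chain_rel X d g \<subseteq> metric_chain_rel X d h"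
proof -
  have "chain h V x y ps" if "chain g V x y ps" for V x y ps
    using that assms by (auto simp: chain_def)
  then show ?thesis by (fastforce simp: metric_chain_rel_def)
qed

lemma chain_Cons:
  "chain g V x y (p # ps) \<longleftrightarrow> p \<in> g \<and> (x, fst p) \<in> V \<and>
     (if ps = [] then (snd p, y) \<in> V else chain g V (snd p) y ps)"
proof (cases ps)
  case (Cons q qs)
  have "(\<forall>i. Suc i < length (p # ps) \<longrightarrow> (snd ((p # ps) ! i), fst ((p # ps) ! Suc i)) \<in> V) \<longleftrightarrow>
      (snd p, fst q) \<in> V \<and> (\<forall>i. Suc i < length ps \<longrightarrow> (snd (ps ! i), fst (ps ! Suc i)) \<in> V)"
    by (simp add: Cons All_less_Suc2)
  then show ?thesis by (auto simp: chain_def Cons)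
qed (auto simp: chain_def)

lemma relpow_mono_refl:
  assumes "V \<subseteq> A \<times> A" "Id_on A \<subseteq> V" "(u, v) \<in> V ^^ i" "u \<in> A" "i \<le> j"
  shows "(u, v) \<in> V ^^ j"
  using assms(5)
proof (induction j rule: dec_induct)
  case (step j)
  have "v \<in> A"
  proof (cases "j = 0")
    case False
    then show ?thesis using relpow_subset_Times[OF assms(1), of j] step by auto
  qed (use step assms in simp)
  then show ?case using step assms(2) by auto
qed (rule assms)

text \<open>Deleting a pair with equal entries merges the jump into it with the jump out of it. Here
  \<open>z\<close> is the start of the jump being assembled and \<open>j\<close> the number of jumps
  of \<open>V\<close> already merged into it; after a pair that is kept, \<open>j\<close> restarts
  at 0. The strict bound leaves room for the jump that follows the last pair.\<close>

lemma chain_drop_Id: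
  assumes V: "V \<subseteq> A \<times> A" "Id_on A \<subseteq> V"
    and "chain g V x y ps" "(z, x) \<in> V ^^ j" "z \<in> A" "j + length ps < m"
  shows "if filter (\<lambda>p. fst p \<noteq> snd p) ps = [] then (z, y) \<in> V ^^ m
    else chain (g - Id) (V ^^ m) z y (filter (\<lambda>p. fst p \<noteq> snd p) ps)"
  using assms(3-)
proof (induction ps arbitrary: z x j)
  case Nil
  then show ?case by (simp add: chain_def)
next
  case (Cons p ps)
  have p: "p \<in> g" "(x, fst p) \<in> V" using Cons.prems(1) by (simp_all add: chain_Cons)
  have zp: "(z, fst p) \<in> V ^^ Suc j" using Cons.prems(2) p(2) by auto
  have mono: "(u, v) \<in> V ^^ m" if "(u, v) \<in> V ^^ i" "u \<in> A" "i \<le> m" for u v i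
    using relpow_mono_refl[OF V] that by blast
  have sA: "snd p \<in> A"
  proof (cases ps)
    case Nil
    then show ?thesis using Cons.prems(1) V(1) by (auto simp: chain_Cons)
  next
    case (Cons q qs)
    then show ?thesis using Cons.prems(1) V(1) by (auto simp: chain_Cons)
  qed
  have zm: "(z, fst p) \<in> V ^^ m" using zp Cons.prems by (intro mono[of _ _ "Suc j"]) auto
  show ?case
  proof (cases "ps = []")
    case True
    then have py: "(snd p, y) \<in> V" using Cons.prems(1) by (simp add: chain_Cons)
    show ?thesis
    proof (cases "fst p = snd p")
      case eq: True
      then have "(z, y) \<in> V ^^ Suc (Suc j)" using zp py by (metis relpow_Suc_I)
      then have "(z, y) \<in> V ^^ m" by (rule mono) (use True Cons.prems in auto)
      then show ?thesis using eq True by simp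
    next
      case False
      have "(snd p, y) \<in> V ^^ m" using py sA Cons.prems by (intro mono[of _ _ 1]) auto
      moreover have "p \<in> g - Id" using False p by (cases p) auto
      ultimately show ?thesis using False True zm by (simp add: chain_Cons)
    qed
  next
    case ne: False
    then have ch: "chain g V (snd p) y ps" using Cons.prems(1) by (simp add: chain_Cons)
    show ?thesis
    proof (cases "fst p = snd p")
      case True
      then show ?thesis
        using Cons.IH[OF ch, of z "Suc j"] zp Cons.prems by simp
    next
      case False
      have "p \<in> g - Id" using False p by (cases p) auto
      moreover have "if filter (\<lambda>p. fst p \<noteq> snd p) ps = [] then (snd p, y) \<in> V ^^ m
          else chain (g - Id) (V ^^ m) (snd p) y (filter (\<lambda>p. fst p \<noteq> snd p) ps)"
        by (rule Cons.IH[OF ch, of _ 0]) (use sA Cons.prems in auto)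
      ultimately show ?thesis using False zm by (simp add: chain_Cons)
    qed
  qed
qed

section \<open>Following a chain by a path with disjoint jumps\<close>

context Metric_space
begin

text \<open>
  The second alternative is the postponed jump: \<open>u = a i\<close> is the departure point of an earlier jump, and
  the next point after \<open>u\<close> will be replaced by \<open>u\<close> itself, which leads to \<open>arrival f x a (Suc i)\<close>.
\<close>
definition tracks :: "('a \<Rightarrow> 'a) \<Rightarrow> 'a set \<Rightarrow> real \<Rightarrow> real \<Rightarrow> 'a \<Rightarrow> 'a \<Rightarrow> bool" where
  "tracks f A \<eta> \<omega> x u \<longleftrightarrow> (\<exists>a n. matched d f A \<eta> x a n \<and> fresh f x a n (arrival f x a n) \<and>
     (d (arrival f x a n) u < \<omega> \<or> u \<in> a ` {..<n}))"

text \<open>This is the part of a step that precedes any question about the position of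
  \<open>f \<alpha>\<close>. Either a cut path already ends near \<open>f \<alpha>\<close>, or a
  path can be extended by a jump to \<alpha>.\<close>

lemma tracks_approach:
  assumes f: "f \<in> M \<rightarrow> M" and A: "A \<subseteq> M" and x: "x \<in> M"
    and uc: "\<forall>p\<in>M. \<forall>q\<in>M. d p q < \<epsilon> \<longrightarrow> d (f p) (f q) < \<omega>"
    and pos: "0 < \<omega>" "0 < \<epsilon>" "\<omega> + \<epsilon> \<le> \<eta>"
    and tr: "tracks f A \<eta> \<omega> x u" and u: "u \<in> M" and \<alpha>: "\<alpha> \<in> A" "d u \<alpha> < \<epsilon>"
  obtains (arrived) a n where "n > 0" "matched d f A \<eta> x a n" "fresh f x a n (arrival f x a n)"
      "d (arrival f x a n) (f \<alpha>) < \<omega>"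
  | (extend) a n where "matched d f A \<eta> x a n" "fresh f x a n (arrival f x a n)" "fresh f x a n \<alpha>"
      "d (arrival f x a n) \<alpha> < \<eta>"
proof -
  obtain a n where m: "matched d f A \<eta> x a n" and fr: "fresh f x a n (arrival f x a n)"
    and c: "d (arrival f x a n) u < \<omega> \<or> u \<in> a ` {..<n}"
    using tr by (auto simp: tracks_def)
  have aA: "a i \<in> M" if "i < n" for i using m that A by (auto simp: matched_def)
  have arrM: "arrival f x a i \<in> M" if "i \<le> n" for i
    using that aA f x by (cases i) (auto simp: Pi_iff)
  have \<alpha>M: "\<alpha> \<in> M" using A \<alpha> by auto
  have cut: "matched d f A \<eta> x a k \<and> fresh f x a k (arrival f x a k)" if "k \<le> n" for k
    using that m fr matched_truncate[OF m] matched_fresh[OF m] by (cases "k = n") auto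
  \<comment> \<open>A departure point \<open>a k\<close> equal to \<open>u\<close> (a postponed
    jump) or to \<alpha> can replace \<alpha>: the path is cut right after it. Its image is compared
    directly with \<open>f \<alpha>\<close>, so the error \<omega> does not depend on earlier
    errors.\<close>
  show thesis
  proof (cases "\<exists>k<n. d (a k) \<alpha> < \<epsilon> \<and> (a k = u \<or> a k = \<alpha>)")
    case True
    then obtain k where k: "k < n" "d (a k) \<alpha> < \<epsilon>" by blast
    then have "d (f (a k)) (f \<alpha>) < \<omega>" using uc aA \<alpha>M by blast
    then show thesis using arrived[of "Suc k" a] cut[of "Suc k"] k by simp
  next
    case False
    then have no: "\<alpha> \<noteq> a k" "u \<noteq> a k" if "k < n" for k
      using that \<alpha> \<alpha>M pos(2) zero[OF \<alpha>M \<alpha>M] by metis+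
    then have "d (arrival f x a n) u < \<omega>" using c by auto
    then have near: "d (arrival f x a n) \<alpha> < \<eta>"
      using triangle[of "arrival f x a n" u \<alpha>] arrM[of n] u \<alpha> \<alpha>M pos by auto
    show thesis
    \<comment> \<open>If the path has already arrived at \<alpha>, it is cut there and the new jump
      is the single point \<alpha>.\<close>
    proof (cases "\<exists>k<n. \<alpha> = arrival f x a k")
      case True
      then obtain k where k: "k < n" "\<alpha> = arrival f x a k" by blast
      then have "fresh f x a k \<alpha>" using cut[of k] by simp
      moreover have "d (arrival f x a k) \<alpha> < \<eta>" using k \<alpha>M pos by auto
      ultimately show thesis using extend[of a k] cut[of k] k by simp
    next
      case False
      then have "fresh f x a n \<alpha>" using no by (auto simp: fresh_def)
      then show thesis using extend[of a n] m fr near by blast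
    qed
  qed
qed

text \<open>After an extension to \<alpha> there are three positions for \<open>f \<alpha>\<close>.
  If it is fresh, it is the new end; if it is an arrival point, the path is cut there and ends
  exactly at \<open>f \<alpha>\<close>; if it is an earlier departure point, the jump is postponed
  and the path before the extension is kept.\<close>

lemma tracks_step:
  assumes f: "f \<in> M \<rightarrow> M" and A: "A \<subseteq> M" "\<forall>p\<in>A. f p \<noteq> p" and x: "x \<in> M"
    and uc: "\<forall>p\<in>M. \<forall>q\<in>M. d p q < \<epsilon> \<longrightarrow> d (f p) (f q) < \<omega>"
    and pos: "0 < \<omega>" "0 < \<epsilon>" "\<omega> + \<epsilon> \<le> \<eta>"
    and tr: "tracks f A \<eta> \<omega> x u" and u: "u \<in> M" and \<alpha>: "\<alpha> \<in> A" "d u \<alpha> < \<epsilon>"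
  shows "tracks f A \<eta> \<omega> x (f \<alpha>)"
  using f A(1) x uc pos tr u \<alpha>
proof (cases rule: tracks_approach)
  case (arrived a n)
  then show ?thesis by (auto simp: tracks_def)
next
  case (extend a n)
  let ?b = "a(n := \<alpha>)"
  have m: "matched d f A \<eta> x ?b (Suc n)"
    using extend \<alpha> by (intro matched_extend) auto
  have f\<alpha>: "f \<alpha> \<in> M" using f A \<alpha> by auto
  consider "fresh f x ?b (Suc n) (f \<alpha>)" | k where "k < Suc n" "f \<alpha> = arrival f x ?b k"
    | k where "k < Suc n" "f \<alpha> = ?b k"
    unfolding fresh_def by blast
  then show ?thesis
  proof cases
    case 1
    then show ?thesis using m f\<alpha> pos unfolding tracks_def
      by (intro exI[of _ ?b] exI[of _ "Suc n"]) simp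
  next
    case 2
    then show ?thesis using matched_truncate[OF m] matched_fresh[OF m] f\<alpha> pos
      unfolding tracks_def by (intro exI[of _ ?b] exI[of _ k]) simp
  next
    case 3
    then have "k < n" "f \<alpha> = a k" using A(2) \<alpha> by (auto simp: less_Suc_eq split: if_splits)
    \<comment> \<open>\<open>k = n\<close> would make \<open>\<alpha>\<close> a fixed point; this is the only place where that matters.\<close>
    then show ?thesis using extend unfolding tracks_def by blast
  qed
qed

text \<open>The invariant \<open>tracks\<close> is carried only up to the last departure point. One
  step further it could hold through a postponed jump, whose path need not end near
  \<open>y\<close>; \<open>tracks_approach\<close> instead yields a path that ends within \<omega>
  of the last image or exactly at it.\<close>

lemma matched_shadow:
  assumes f: "f \<in> M \<rightarrow> M" and A: "A \<subseteq> M" "\<forall>p\<in>A. f p \<noteq> p" and x: "x \<in> M" and y: "y \<in> M"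
    and uc: "\<forall>p\<in>M. \<forall>q\<in>M. d p q < \<epsilon> \<longrightarrow> d (f p) (f q) < \<omega>"
    and pos: "0 < \<omega>" "0 < \<epsilon>" "\<omega> + \<epsilon> \<le> \<eta>"
    and ch: "\<And>i. i < N \<Longrightarrow> \<alpha> i \<in> A \<and> d (arrival f x \<alpha> i) (\<alpha> i) < \<epsilon>"
    and N: "N > 0" "d (arrival f x \<alpha> N) y < \<epsilon>"
  obtains a n where "n > 0" "matched d f A \<eta> x a n" "d (arrival f x a n) y < \<eta>"
proof -
  obtain L where L: "N = Suc L" using N gr0_conv_Suc by blast
  have arrM: "arrival f x \<alpha> i \<in> M" if "i \<le> N" for i
    using that ch f A(1) x by (cases i) (auto simp: Pi_iff subset_iff)
  have tr: "tracks f A \<eta> \<omega> x (arrival f x \<alpha> i)" if "i < N" for i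
    using that
  proof (induction i)
    case 0
    show ?case using x pos unfolding tracks_def
      by (intro exI[of _ \<alpha>] exI[of _ 0]) (simp add: matched_def fresh_def)
  next
    case (Suc i)
    then have "tracks f A \<eta> \<omega> x (arrival f x \<alpha> i)" by simp
    then have "tracks f A \<eta> \<omega> x (f (\<alpha> i))"
      by (rule tracks_step[OF f A x uc pos]) (use Suc.prems ch arrM in auto)
    then show ?case by simp
  qed
  have A': "\<alpha> L \<in> A" "d (arrival f x \<alpha> L) (\<alpha> L) < \<epsilon>" "arrival f x \<alpha> L \<in> M"
    using ch L arrM by auto
  have fin: "f (\<alpha> L) \<in> M" "d (f (\<alpha> L)) y < \<epsilon>" using N L arrM[of N] by auto
  have trL: "tracks f A \<eta> \<omega> x (arrival f x \<alpha> L)" using tr L by simp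
  from f A(1) x uc pos trL A'(3,1,2) show thesis
  proof (cases rule: tracks_approach)
    case (arrived a n)
    have "arrival f x a n \<in> M" using arrived f A x
      by (cases n) (auto simp: matched_def Pi_iff subset_iff)
    then have "d (arrival f x a n) y < \<eta>"
      using triangle[of "arrival f x a n" "f (\<alpha> L)" y] arrived fin y pos by auto
    then show thesis using arrived that by blast
  next
    case (extend a n)
    show thesis
      by (rule that[of "Suc n" "a(n := \<alpha> L)"])
        (use extend A' fin pos in \<open>auto intro!: matched_extend\<close>)
  qed
qed

section \<open>Neighborhoods of the diagonal with small iterates\<close>

text \<open>Pairwise disjoint jumps are classes of an equivalence relation, so being transitive
  costs them no increase in size. Only the final jump into \<open>y\<close> may meet other
  jumps.\<close>

lemma matched_classes:
  assumes f: "f \<in> M \<rightarrow> M" and A: "A \<subseteq> M" and x: "x \<in> M" and y: "y \<in> M" and \<eta>: "\<eta> > 0"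
    and m: "matched d f A \<eta> x a n" and last: "d (arrival f x a n) y < \<eta>"
  obtains T where "finite T" "sym T" "trans T" "T \<subseteq> M \<times> M" "\<forall>(p, q)\<in>T. d p q \<le> 3 * \<eta>"
    "\<forall>i<n. (arrival f x a i, a i) \<in> T" "(arrival f x a n, y) \<in> T"
proof
  let ?b = "arrival f x a"
  define P where "P = ?b ` {..n} \<union> a ` {..<n} \<union> {y}"
  define E where "E = {(p, q). p = q \<or> (\<exists>i<n. p \<in> {?b i, a i} \<and> q \<in> {?b i, a i})}"
  \<comment> \<open>\<open>B\<close> joins the classes of the two ends of the final jump. Two of its
    points are at most three jumps apart, which explains the bound
    \<open>3 * \<eta>\<close>.\<close>
  define B where "B = {p. (?b n, p) \<in> E \<or> (y, p) \<in> E}"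
  define T where "T = {(p, q). p \<in> P \<and> q \<in> P \<and> ((p, q) \<in> E \<or> p \<in> B \<and> q \<in> B)}"
  have aM: "a i \<in> M" if "i < n" for i using m that A by (auto simp: matched_def)
  have bM: "?b i \<in> M" if "i \<le> n" for i
    using that aM f x by (cases i) (auto simp: Pi_iff)
  have PM: "P \<subseteq> M" using aM bM y by (auto simp: P_def)
  have disj: "i = j" if "i < n" "j < n" "p \<in> {?b i, a i}" "p \<in> {?b j, a j}" for i j p
    using m that unfolding matched_def inj_on_def by (metis empty_iff insert_iff lessThan_iff)
  have symE: "(q, p) \<in> E" if "(p, q) \<in> E" for p q using that by (auto simp: E_def)
  have transE: "(p, r) \<in> E" if "(p, q) \<in> E" "(q, r) \<in> E" for p q r
    using that disj unfolding E_def by blast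
  have BE: "q \<in> B" if "p \<in> B" "(p, q) \<in> E" for p q
    using that transE unfolding B_def by blast
  have dE: "d p q < \<eta>" if "(p, q) \<in> E" "p \<in> P" for p q
  proof -
    have "p \<in> M" using that PM by blast
    then show ?thesis
      using that m \<eta> aM bM unfolding E_def matched_def by (auto simp: commute)
  qed
  have EP: "q \<in> P" if "(p, q) \<in> E" "p \<in> P" for p q
    using that by (auto simp: E_def P_def)
  have bP: "?b n \<in> P" "y \<in> P" by (auto simp: P_def)
  have near: "d (?b n) p < 2 * \<eta>" if p: "p \<in> B" for p
  proof -
    have "p \<in> M" using p EP bP PM unfolding B_def by blast
    moreover have "d (?b n) p < \<eta> \<or> d y p < \<eta>" using p dE bP by (auto simp: B_def)
    ultimately show ?thesis using triangle[of "?b n" y p] last \<eta> y bM[of n] by auto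
  qed
  have dB: "d p q \<le> 3 * \<eta>" if p: "p \<in> B" and q: "q \<in> B" for p q
  proof -
    have M: "p \<in> M" "q \<in> M" using p q EP bP PM unfolding B_def by blast+
    have *: "d (?b n) p < \<eta> \<or> d y p < \<eta>" "d (?b n) q < \<eta> \<or> d y q < \<eta>"
      using p q dE bP by (auto simp: B_def)
    show ?thesis
      using * last M y bM[of n] triangle[of p "?b n" q] triangle[of p y q] \<eta>
        near[OF p] near[OF q] triangle[of p "?b n" q]
      by (smt (verit) commute order_refl)
  qed
  show "finite T" by (rule finite_subset[of _ "P \<times> P"]) (auto simp: T_def P_def)
  show "sym T" using symE by (auto simp: sym_def T_def)
  show "trans T" using transE BE symE unfolding trans_def T_def by blast
  show "T \<subseteq> M \<times> M" using PM by (auto simp: T_def)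
  show "\<forall>(p, q)\<in>T. d p q \<le> 3 * \<eta>"
    using dE dB \<eta> by (fastforce simp: T_def)
  show "\<forall>i<n. (?b i, a i) \<in> T" by (auto simp: T_def P_def E_def)
  show "(?b n, y) \<in> T" by (auto simp: T_def P_def E_def B_def)
qed

text \<open>
  A path with \<open>m\<close> steps, each either of size at most \<open>r\<close> or inside a class of \<open>T\<close>, uses at most
  one class: with \<open>m * r\<close> below the separation of the points of \<open>T\<close>, two consecutive steps in \<open>T\<close>
  have to meet.
\<close>
lemma relpow_thickening:
  assumes T: "finite T" "trans T" "T \<subseteq> M \<times> M" and small: "\<forall>(p, q)\<in>T. d p q < \<delta>"
    and "\<delta> > 0" "m > 0"
  obtains r where "r > 0" "({(u, v) \<in> M \<times> M. d u v \<le> r} \<union> T) ^^ m \<subseteq> {(u, v). d u v < \<delta>}"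
proof -
  \<comment> \<open>The minimum of \<open>S\<close> bounds the total length of the small steps: it
    is at most the slack \<delta> - \<open>d p q\<close> left by each pair of \<open>T\<close>, and
    at most the distance from the end of a pair to any different starting point of a pair. The
    element \<delta> handles walks that use no pair of \<open>T\<close>.\<close>
  define S where "S = insert \<delta> ((\<lambda>(p, q). \<delta> - d p q) ` T \<union>
    (\<lambda>(p, q). d p q) ` {(p, q) \<in> Range T \<times> Domain T. p \<noteq> q})"
  have "finite {(p, q) \<in> Range T \<times> Domain T. p \<noteq> q}"
    by (rule finite_subset[of _ "Range T \<times> Domain T"]) (use T in \<open>auto simp: finite_Range finite_Domain\<close>)
  then have fin: "finite S" using T by (simp add: S_def)
  have posS: "t > 0" if "t \<in> S" for t
    using that assms by (auto simp: S_def intro!: mdist_pos_less)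
  define s where "s = Min S"
  have s: "s > 0" "\<And>t. t \<in> S \<Longrightarrow> s \<le> t"
    using fin posS by (auto simp: s_def S_def)
  define r where "r = s / (real m + 1)"
  have r: "r > 0" using s by (simp add: r_def)
  have jr: "real j * r < s" if "j \<le> m" for j
  proof -
    have "real j * s < (real m + 1) * s" using that s(1) by simp
    then show ?thesis by (simp add: r_def field_simps)
  qed
  let ?V = "{(u, v) \<in> M \<times> M. d u v \<le> r} \<union> T"
  have key: "v \<in> M \<and> (d u v \<le> real j * r \<or> (\<exists>p q. (p, q) \<in> T \<and> d u p + d q v \<le> real j * r))"
    if "(u, v) \<in> ?V ^^ j" "u \<in> M" "j \<le> m" for u v j
    using that
  proof (induction j arbitrary: v)
    case 0
    then show ?case by simp
  next
    case (Suc j)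
    from Suc.prems(1) obtain w where uw: "(u, w) \<in> ?V ^^ j" and wv: "(w, v) \<in> ?V"
      by (rule relpow_Suc_E)
    have IH: "w \<in> M" "d u w \<le> real j * r \<or> (\<exists>p q. (p, q) \<in> T \<and> d u p + d q w \<le> real j * r)"
      using Suc.IH[OF uw] Suc.prems by auto
    have vM: "v \<in> M" using wv T by auto
    have mono: "real j * r \<le> real (Suc j) * r" "real (Suc j) * r = real j * r + r"
      using r by (simp_all add: algebra_simps)
    show ?case
    proof (cases "d w v \<le> r")
      case True
      from IH(2) show ?thesis
      proof (elim disjE exE conjE)
        assume "d u w \<le> real j * r"
        then show ?thesis using True triangle[of u w v] vM IH(1) Suc.prems mono by auto
      next
        fix p q assume pq: "(p, q) \<in> T" "d u p + d q w \<le> real j * r"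
        then have "q \<in> M" using T by auto
        then have "d u p + d q v \<le> real (Suc j) * r"
          using True triangle[of q w v] vM IH(1) mono pq by auto
        then show ?thesis using pq vM by blast
      qed
    next
      case False
      then have wvT: "(w, v) \<in> T" using wv by auto
      from IH(2) show ?thesis
      proof (elim disjE exE conjE)
        assume "d u w \<le> real j * r"
        then have "d u w + d v v \<le> real (Suc j) * r" using vM mono by simp
        then show ?thesis using wvT vM by blast
      next
        fix p q assume pq: "(p, q) \<in> T" "d u p + d q w \<le> real j * r"
        have "d q w < s" using pq jr[of j] Suc.prems nonneg[of u p] by linarith
        have "q = w"
        proof (rule ccontr)
          assume "q \<noteq> w"
          then have "d q w \<in> S" using pq wvT by (force simp: S_def)
          then show False using s \<open>d q w < s\<close> by force
        qed
        then have "(p, v) \<in> T" using pq wvT T(2) by (blast dest: transD)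
        moreover have "d u p + d v v \<le> real (Suc j) * r"
          using pq mono mdist_zero[OF vM] nonneg[of q w] by linarith
        ultimately show ?thesis using vM by blast
      qed
    qed
  qed
  have "d u v < \<delta>" if uv: "(u, v) \<in> ?V ^^ m" for u v
  proof -
    obtain k where "m = Suc k" using \<open>m > 0\<close> gr0_conv_Suc by blast
    from uv[unfolded this] obtain w where "(u, w) \<in> ?V" by (rule relpow_Suc_E2)
    then have uM: "u \<in> M" using T by auto
    have vM: "v \<in> M" using key[OF uv uM] by simp
    have "s \<le> \<delta>" using s by (simp add: S_def)
    consider "d u v \<le> real m * r" | p q where "(p, q) \<in> T" "d u p + d q v \<le> real m * r"
      using key[OF uv uM] by blast
    then show ?thesis
    proof cases
      case 1
      then show ?thesis using jr[of m] \<open>s \<le> \<delta>\<close> by simp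
    next
      case 2
      then have "p \<in> M" "q \<in> M" using T by auto
      moreover have "s \<le> \<delta> - d p q" using 2 by (intro s(2)) (force simp: S_def)
      ultimately show ?thesis
        using 2 jr[of m] triangle[of u p v] triangle[of p q v] uM vM by simp
    qed
  qed
  then show thesis using that[OF r] by auto
qed

text \<open>The open sets \<open>B\<close> with \<open>B \<times> B \<subseteq> U\<close> cover the
  space, and a Lebesgue number of this cover serves as \<delta>.\<close>

lemma diag_nhd_contains_dist:
  assumes "compact_space mtopology" "diag_nhd mtopology W"
  obtains \<delta> where "\<delta> > 0" "\<forall>u\<in>M. \<forall>v\<in>M. d u v < \<delta> \<longrightarrow> (u, v) \<in> W"
proof -
  obtain U where U: "openin (prod_topology mtopology mtopology) U" "Id_on M \<subseteq> U" "U \<subseteq> W"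
    using assms(2) by (auto simp: diag_nhd_def)
  let ?C = "{B. openin mtopology B \<and> B \<times> B \<subseteq> U}"
  have "M \<subseteq> \<Union>?C"
  proof
    fix z assume "z \<in> M"
    then have "(z, z) \<in> U" using U by auto
    with U(1)[unfolded openin_prod_topology_alt] obtain G H
      where "openin mtopology G" "openin mtopology H" "z \<in> G" "z \<in> H" "G \<times> H \<subseteq> U"
      by metis
    then have "G \<inter> H \<in> ?C" "z \<in> G \<inter> H" by (simp add: openin_Int, blast, simp)
    then show "z \<in> \<Union>?C" by (rule UnionI)
  qed
  then obtain \<epsilon> where e: "\<epsilon> > 0" "\<forall>x\<in>M. \<exists>B\<in>?C. mball x \<epsilon> \<subseteq> B"
    using lebesgue_number[of M ?C] assms(1) unfolding compact_space_def topspace_mtopology by blast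
  have "(u, v) \<in> W" if uv: "u \<in> M" "v \<in> M" "d u v < \<epsilon>" for u v
  proof -
    obtain B where B: "B \<in> ?C" "mball u \<epsilon> \<subseteq> B" using bspec[OF e(2) uv(1)] ..
    have "u \<in> mball u \<epsilon>" "v \<in> mball u \<epsilon>" using uv e(1) by auto
    then have "(u, v) \<in> B \<times> B" using B(2) by blast
    then show ?thesis using B(1) U(3) by blast
  qed
  then show thesis using that e by blast
qed

lemma continuous_map_dist:
  "continuous_map (prod_topology mtopology mtopology) euclidean (\<lambda>(u, v). d u v)"
  using continuous_map_metric[of Self] by (simp add: mtopology_of_def)

lemma diag_nhd_dist:
  assumes "r > 0" "{(u, v) \<in> M \<times> M. d u v < r} \<subseteq> V" "V \<subseteq> M \<times> M"
  shows "diag_nhd mtopology V"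
proof -
  have "openin (prod_topology mtopology mtopology)
      {z \<in> topspace (prod_topology mtopology mtopology). (case z of (u, v) \<Rightarrow> d u v) \<in> {..<r}}"
    using continuous_map_dist by (rule openin_continuous_map_preimage) simp
  moreover have "{z \<in> topspace (prod_topology mtopology mtopology). (case z of (u, v) \<Rightarrow> d u v) \<in> {..<r}} =
      {(u, v) \<in> M \<times> M. d u v < r}" by auto
  ultimately show ?thesis using assms unfolding diag_nhd_def by fastforce
qed

lemma closedin_thickening:
  assumes "finite T" "T \<subseteq> M \<times> M"
  shows "closedin (prod_topology mtopology mtopology) ({(u, v) \<in> M \<times> M. d u v \<le> r} \<union> T)"
proof (rule closedin_Un)
  have "closedin (prod_topology mtopology mtopology)
      {z \<in> topspace (prod_topology mtopology mtopology). (case z of (u, v) \<Rightarrow> d u v) \<in> {..r}}"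
    using continuous_map_dist by (rule closedin_continuous_map_preimage) simp
  moreover have "{z \<in> topspace (prod_topology mtopology mtopology). (case z of (u, v) \<Rightarrow> d u v) \<in> {..r}} =
      {(u, v) \<in> M \<times> M. d u v \<le> r}" by auto
  ultimately show "closedin (prod_topology mtopology mtopology) {(u, v) \<in> M \<times> M. d u v \<le> r}" by simp
  show "closedin (prod_topology mtopology mtopology) T"
    using assms by (intro closedin_Hausdorff_finite)
      (auto simp: Hausdorff_space_prod_topology Hausdorff_space_mtopology)
qed

section \<open>The two inclusions\<close>

text \<open>The length \<open>n\<close> and the relation \<open>T\<close> are found before the
  thickness \<open>r\<close> is chosen. Hence \<open>r\<close> may depend on \<open>n\<close>, and
  the exponent \<open>3 ^ n\<close> is harmless however long the chain is.\<close>

lemma W_relI: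
  assumes comp: "compact_space mtopology" and x: "x \<in> M" and y: "y \<in> M"
    and ex: "\<And>\<delta>. \<delta> > 0 \<Longrightarrow> \<exists>n a T. n > 0 \<and> finite T \<and> sym T \<and> trans T \<and> T \<subseteq> M \<times> M \<and>
        (\<forall>(p, q)\<in>T. d p q < \<delta>) \<and> (\<forall>i<n. a i \<in> M \<and> (arrival f x a i, a i) \<in> T) \<and>
        (arrival f x a n, y) \<in> T"
  shows "(x, y) \<in> W_rel mtopology (graph_on mtopology f)"
proof -
  have "\<exists>V n. diag_nhd mtopology V \<and> closedin (prod_topology mtopology mtopology) V \<and> sym V \<and> n \<ge> 1 \<and>
          (\<exists>ps. chain (graph_on mtopology f) V x y ps \<and> length ps = n) \<and> V ^^ (3 ^ n) \<subseteq> W"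
    if W: "diag_nhd mtopology W" for W
  proof -
    obtain \<delta> where \<delta>: "\<delta> > 0" "\<forall>u\<in>M. \<forall>v\<in>M. d u v < \<delta> \<longrightarrow> (u, v) \<in> W"
      using diag_nhd_contains_dist[OF comp W] by blast
    obtain n a T where n: "n > 0" and T: "finite T" "sym T" "trans T" "T \<subseteq> M \<times> M"
        "\<forall>(p, q)\<in>T. d p q < \<delta>" and a: "\<forall>i<n. a i \<in> M \<and> (arrival f x a i, a i) \<in> T"
        "(arrival f x a n, y) \<in> T"
      using ex[OF \<delta>(1)] by blast
    obtain r where r: "r > 0" "({(u, v) \<in> M \<times> M. d u v \<le> r} \<union> T) ^^ (3 ^ n) \<subseteq> {(u, v). d u v < \<delta>}"
      by (rule relpow_thickening[OF T(1,3,4,5) \<delta>(1), of "3 ^ n"]) auto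
    let ?V = "{(u, v) \<in> M \<times> M. d u v \<le> r} \<union> T"
    have VM: "?V \<subseteq> M \<times> M" using T by auto
    have "?V ^^ (3 ^ n) \<subseteq> M \<times> M" using VM by (rule relpow_subset_Times) simp
    then have "?V ^^ (3 ^ n) \<subseteq> W" using r(2) \<delta>(2) by blast
    moreover have "diag_nhd mtopology ?V" by (rule diag_nhd_dist[OF r(1)]) (use VM in auto)
    moreover have "closedin (prod_topology mtopology mtopology) ?V" by (rule closedin_thickening) fact+
    moreover have "sym ?V" using T(2) by (auto simp: sym_def commute)
    moreover have "chain (graph_on mtopology f) ?V x y (map (\<lambda>i. (a i, f (a i))) [0..<n])"
      using a by (subst chain_graph_on_iff[OF n]) auto
    ultimately show ?thesis using n
      by (intro exI[of _ ?V] exI[of _ n]) (fastforce simp del: upt_Suc)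
  qed
  then show ?thesis using x y by (auto simp: W_rel_def)
qed

lemma uniformly_continuous_dist:
  assumes "compact_space mtopology" "continuous_map mtopology mtopology f" "\<epsilon> > 0"
  obtains \<delta> where "\<delta> > 0" "\<forall>p\<in>M. \<forall>q\<in>M. d p q < \<delta> \<longrightarrow> d (f p) (f q) < \<epsilon>"
proof -
  have "uniformly_continuous_map Self Self f"
    by (rule continuous_imp_uniformly_continuous_map) (use assms in \<open>simp add: mtopology_of_def\<close>)
  then have "\<exists>\<delta>>0. \<forall>p\<in>M. \<forall>q\<in>M. d q p < \<delta> \<longrightarrow> d (f q) (f p) < \<epsilon>"
    using assms(3) unfolding uniformly_continuous_map_def mspace_Self mdist_Self by blast
  then show thesis using that by blast
qed

lemma fixed_in_W_rel:
  assumes "compact_space mtopology" "x \<in> M" "f x = x"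
  shows "(x, x) \<in> W_rel mtopology (graph_on mtopology f)"
proof (rule W_relI[OF assms(1,2,2)])
  fix \<delta> :: real assume "\<delta> > 0"
  then show "\<exists>n a T. n > 0 \<and> finite T \<and> sym T \<and> trans T \<and> T \<subseteq> M \<times> M \<and>
        (\<forall>(p, q)\<in>T. d p q < \<delta>) \<and> (\<forall>i<n. a i \<in> M \<and> (arrival f x a i, a i) \<in> T) \<and>
        (arrival f x a n, x) \<in> T"
    using assms(2,3)
    by (intro exI[of _ "Suc 0"] exI[of _ "\<lambda>_. x"] exI[of _ "{(x, x)}"]) (auto simp: sym_def trans_def)
qed

lemma chain_closure_nonfixed_in_W_rel:
  assumes comp: "compact_space mtopology" and cont: "continuous_map mtopology mtopology f"
    and A: "A \<subseteq> M" "\<forall>p\<in>A. f p \<noteq> p"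
    and xy: "(x, y) \<in> metric_chain_rel mtopology d (Restr (graph_on mtopology f) (mtopology closure_of A))"
  shows "(x, y) \<in> W_rel mtopology (graph_on mtopology f)"
proof -
  let ?K = "mtopology closure_of A"
  have f: "f \<in> M \<rightarrow> M" using continuous_map_funspace[OF cont] by simp
  have x: "x \<in> M" and y: "y \<in> M" using xy by (auto simp: metric_chain_rel_def)
  show ?thesis
  proof (rule W_relI[OF comp x y])
    fix \<delta> :: real assume \<delta>: "\<delta> > 0"
    obtain \<epsilon>\<^sub>0 where e0: "\<epsilon>\<^sub>0 > 0" "\<forall>p\<in>M. \<forall>q\<in>M. d p q < \<epsilon>\<^sub>0 \<longrightarrow> d (f p) (f q) < \<delta> / 8"
      using uniformly_continuous_dist[OF comp cont, of "\<delta> / 8"] \<delta> by auto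
    \<comment> \<open>The extraction of disjoint jumps is run with \<omega> = \<delta> / 8 and
      \<eta> = \<delta> / 4, which requires \<epsilon> \<le> \<delta> / 8. The resulting classes
      have size at most 3 \<delta> / 4, below \<delta>.\<close>
    define \<epsilon> where "\<epsilon> = min \<epsilon>\<^sub>0 (\<delta> / 8)"
    have e: "\<epsilon> > 0" "\<delta> / 8 + \<epsilon> \<le> \<delta> / 4"
      and uc: "\<forall>p\<in>M. \<forall>q\<in>M. d p q < \<epsilon> \<longrightarrow> d (f p) (f q) < \<delta> / 8"
      using e0 \<delta> by (auto simp: \<epsilon>_def)
    \<comment> \<open>A jump of the perturbed chain is bounded by three distances: the shift of the
      arrival point, the original jump and the shift of the departure point.\<close>
    define \<zeta> where "\<zeta> = \<epsilon> / 3"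
    have z: "\<zeta> > 0" "3 * \<zeta> = \<epsilon>" using e by (simp_all add: \<zeta>_def)
    obtain \<epsilon>\<^sub>1 where e1: "\<epsilon>\<^sub>1 > 0" "\<forall>p\<in>M. \<forall>q\<in>M. d p q < \<epsilon>\<^sub>1 \<longrightarrow> d (f p) (f q) < \<zeta>"
      using uniformly_continuous_dist[OF comp cont z(1)] by blast
    have "\<exists>q\<in>A. d p q < \<zeta> \<and> d (f p) (f q) < \<zeta>" if p: "p \<in> ?K" for p
    proof -
      have "min \<zeta> \<epsilon>\<^sub>1 > 0" using z e1 by simp
      then obtain q where "q \<in> A" "q \<in> mball p (min \<zeta> \<epsilon>\<^sub>1)" using p unfolding metric_closure_of by blast
      then show ?thesis using e1(2) by auto
    qed
    then obtain h where h: "\<And>p. p \<in> ?K \<Longrightarrow> h p \<in> A \<and> d p (h p) < \<zeta> \<and> d (f p) (f (h p)) < \<zeta>"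
      by metis
    obtain ps where ps: "chain (Restr (graph_on mtopology f) ?K) {(u, v). d u v < \<zeta>} x y ps"
      using xy z by (auto simp: metric_chain_rel_def)
    then have psK: "set ps \<subseteq> ?K \<times> ?K" and "chain (graph_on mtopology f) {(u, v). d u v < \<zeta>} x y ps"
      by (auto simp: chain_def)
    then obtain c N where N: "N > 0" and ps_eq: "ps = map (\<lambda>i. (c i, f (c i))) [0..<N]"
      and ch: "chain (graph_on mtopology f) {(u, v). d u v < \<zeta>} x y (map (\<lambda>i. (c i, f (c i))) [0..<N])"
      by (metis chain_graph_on_obtain)
    from ch have c: "\<And>i. i < N \<Longrightarrow> c i \<in> M" "\<And>i. i < N \<Longrightarrow> d (arrival f x c i) (c i) < \<zeta>"
      "d (arrival f x c N) y < \<zeta>"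
      unfolding chain_graph_on_iff[OF N] by auto
    have cK: "c i \<in> ?K" if "i < N" for i using psK that by (auto simp: ps_eq image_subset_iff)
    define \<alpha> where "\<alpha> i = h (c i)" for i
    have \<alpha>: "\<alpha> i \<in> A" "\<alpha> i \<in> M" "d (c i) (\<alpha> i) < \<zeta>" "d (f (c i)) (f (\<alpha> i)) < \<zeta>" if "i < N" for i
      using h[OF cK[OF that]] A(1) by (auto simp: \<alpha>_def)
    have fM: "f p \<in> M" if "p \<in> M" for p using f that by blast
    have arrM: "arrival f x c i \<in> M" "arrival f x \<alpha> i \<in> M" if "i \<le> N" for i
      using that x c(1) \<alpha>(2) fM by (cases i; simp)+
    have arr: "d (arrival f x \<alpha> i) (arrival f x c i) < \<zeta>" if "i \<le> N" for i
      using that z(1) x \<alpha>(4) by (cases i) (simp_all add: commute)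
    have step: "\<alpha> i \<in> A \<and> d (arrival f x \<alpha> i) (\<alpha> i) < \<epsilon>" if i: "i < N" for i
      using triangle[of "arrival f x \<alpha> i" "arrival f x c i" "\<alpha> i"]
        triangle[of "arrival f x c i" "c i" "\<alpha> i"] arrM[of i] arr[of i] c(1,2)[OF i] \<alpha>[OF i] i z(2)
      by simp
    have last: "d (arrival f x \<alpha> N) y < \<epsilon>"
      using triangle[of "arrival f x \<alpha> N" "arrival f x c N" y] arrM[of N] arr[of N] c(3) y z by simp
    obtain a n where a: "n > 0" "matched d f A (\<delta> / 4) x a n"
        "d (arrival f x a n) y < \<delta> / 4"
      by (rule matched_shadow[OF f A x y uc _ e _ N last]) (use \<delta> step in auto)
    obtain T where T: "finite T" "sym T" "trans T" "T \<subseteq> M \<times> M" "\<forall>(p, q)\<in>T. d p q \<le> 3 * (\<delta> / 4)"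
      "\<forall>i<n. (arrival f x a i, a i) \<in> T" "(arrival f x a n, y) \<in> T"
      by (rule matched_classes[OF f A(1) x y _ a(2,3)]) (use \<delta> in auto)
    have "\<forall>(p, q)\<in>T. d p q < \<delta>" using T(5) \<delta> by fastforce
    then show "\<exists>n a T. n > 0 \<and> finite T \<and> sym T \<and> trans T \<and> T \<subseteq> M \<times> M \<and>
        (\<forall>(p, q)\<in>T. d p q < \<delta>) \<and> (\<forall>i<n. a i \<in> M \<and> (arrival f x a i, a i) \<in> T) \<and>
        (arrival f x a n, y) \<in> T"
      using a(1) T by blast
  qed
qed

text \<open>If no \<open>\<epsilon>\<^sub>0\<close>-chain of non-fixed points exists, then for every
  \<epsilon> \<le> \<open>\<epsilon>\<^sub>0\<close> deleting the fixed points must empty the chain.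
  So \<open>x\<close> is within \<epsilon> of \<open>y\<close> and of a fixed point, namely the
  first entry of the chain.\<close>

lemma W_rel_cases:
  assumes comp: "compact_space mtopology" and cont: "continuous_map mtopology mtopology f"
    and xy: "(x, y) \<in> W_rel mtopology (graph_on mtopology f)"
  shows "x = y \<and> f x = x \<or> (x, y) \<in> metric_chain_rel mtopology d (graph_on mtopology f - Id)"
proof (rule disjCI)
  let ?F = "graph_on mtopology f"
  assume no: "(x, y) \<notin> metric_chain_rel mtopology d (?F - Id)"
  have x: "x \<in> M" and y: "y \<in> M" using xy by (auto simp: W_rel_def)
  have f: "f \<in> M \<rightarrow> M" using continuous_map_funspace[OF cont] by simp
  obtain \<epsilon>\<^sub>0 where e0: "\<epsilon>\<^sub>0 > 0" "\<And>ps. \<not> chain (?F - Id) {(u, v). d u v < \<epsilon>\<^sub>0} x y ps"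
    using no x y by (auto simp: metric_chain_rel_def)
  have near: "d x y < \<epsilon> \<and> (\<exists>p\<in>M. f p = p \<and> d x p < \<epsilon>)" if e: "0 < \<epsilon>" "\<epsilon> \<le> \<epsilon>\<^sub>0" for \<epsilon>
  proof -
    let ?W = "{(u, v) \<in> M \<times> M. d u v < \<epsilon>}"
    have "diag_nhd mtopology ?W" by (rule diag_nhd_dist[OF e(1)]) auto
    then obtain V ps where V: "diag_nhd mtopology V" and ps: "chain ?F V x y ps"
      and VW: "V ^^ (3 ^ length ps) \<subseteq> ?W"
      using xy by (fastforce simp: W_rel_def)
    have VM: "V \<subseteq> M \<times> M" "Id_on M \<subseteq> V" using V by (auto simp: diag_nhd_def)
    \<comment> \<open>This is the bound of \<open>chain_drop_Id\<close> at \<open>j = 0\<close>: all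
      \<open>n + 1\<close> jumps of a chain of length \<open>n\<close> fit into \<open>3 ^ n\<close>
      compositions.\<close>
    have "length ps < 3 ^ length ps" by (rule power_gt_expt) simp
    then have dr: "if filter (\<lambda>p. fst p \<noteq> snd p) ps = [] then (x, y) \<in> V ^^ (3 ^ length ps)
      else chain (?F - Id) (V ^^ (3 ^ length ps)) x y (filter (\<lambda>p. fst p \<noteq> snd p) ps)"
      using chain_drop_Id[OF VM ps, of x 0] x by simp
    have emp: "filter (\<lambda>p. fst p \<noteq> snd p) ps = []"
    proof (rule ccontr)
      assume "filter (\<lambda>p. fst p \<noteq> snd p) ps \<noteq> []"
      with dr have "chain (?F - Id) (V ^^ (3 ^ length ps)) x y (filter (\<lambda>p. fst p \<noteq> snd p) ps)" by simp
      then have "chain (?F - Id) {(u, v). d u v < \<epsilon>\<^sub>0} x y (filter (\<lambda>p. fst p \<noteq> snd p) ps)"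
        by (rule chain_mono) (use VW e in force)
      then show False using e0 by blast
    qed
    then have "(x, y) \<in> ?W" using dr VW by auto
    moreover obtain p qs where pq: "ps = p # qs" using ps by (cases ps) (auto simp: chain_def)
    have p: "p \<in> ?F" "(x, fst p) \<in> V" using ps by (simp_all add: pq chain_Cons)
    have "(x, fst p) \<in> V ^^ (3 ^ length ps)"
      by (rule relpow_mono_refl[OF VM, of _ _ 1]) (use p x in auto)
    then have "d x (fst p) < \<epsilon>" using VW by auto
    moreover have "fst p = snd p" using emp by (auto simp: pq split: if_splits)
    then have "fst p \<in> M" "f (fst p) = fst p" using p(1) by (auto simp: graph_on_def)
    ultimately show ?thesis by blast
  qed
  have eq: "u = v" if "u \<in> M" "v \<in> M" and small: "\<And>\<epsilon>. 0 < \<epsilon> \<Longrightarrow> \<epsilon> \<le> \<epsilon>\<^sub>0 \<Longrightarrow> d u v < \<epsilon>" for u v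
  proof (rule ccontr)
    assume "u \<noteq> v"
    then have "d u v > 0" using that by (simp add: mdist_pos_less)
    then have "d u v < min (d u v) \<epsilon>\<^sub>0" using e0(1) small[of "min (d u v) \<epsilon>\<^sub>0"] by simp
    then show False by simp
  qed
  have "x = y" using x y near by (intro eq) auto
  moreover have "x = f x"
  proof (rule eq)
    fix \<epsilon> :: real assume e: "0 < \<epsilon>" "\<epsilon> \<le> \<epsilon>\<^sub>0"
    obtain \<delta> where \<delta>: "\<delta> > 0" "\<forall>p\<in>M. \<forall>q\<in>M. d p q < \<delta> \<longrightarrow> d (f p) (f q) < \<epsilon> / 2"
      using uniformly_continuous_dist[OF comp cont, of "\<epsilon> / 2"] e by auto
    have "0 < min \<delta> (\<epsilon> / 2)" "min \<delta> (\<epsilon> / 2) \<le> \<epsilon>\<^sub>0" using \<delta>(1) e by linarith+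
    then obtain p where p: "p \<in> M" "f p = p" "d x p < min \<delta> (\<epsilon> / 2)" using near by blast
    have "d (f x) p < \<epsilon> / 2" using \<delta>(2) p x by fastforce
    moreover have "f x \<in> M" using f x by blast
    ultimately show "d x (f x) < \<epsilon>" using triangle'[of x p "f x"] p x by simp
  qed (use x f in auto)
  ultimately show "x = y \<and> f x = x" by simp
qed

end

theorem theorem8p3:
  fixes X :: "'a topology" and f :: "'a \<Rightarrow> 'a" and F :: "'a rel" and K :: "'a set"
  assumes "compact_space X" and "metrizable_space X"
    and "continuous_map X X f"
  defines "F \<equiv> graph_on X f"
  assumes "{x \<in> topspace X. f x \<in> fixed_set F} = fixed_set F"
  defines "K \<equiv> topspace X - X interior_of (fixed_set F)"
  shows "W_rel X F = Id_on (fixed_set F) \<union> chain_rel X (Restr F K) \<and>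
         fixed_set (W_rel X F) = fixed_set F \<union> fixed_set (chain_rel X (Restr F K))"
proof -
  obtain M d where "Metric_space M d" and X: "X = Metric_space.mtopology M d"
    using assms(2) by (auto simp: metrizable_space_def)
  interpret Metric_space M d by fact
  have comp: "compact_space mtopology" and cont: "continuous_map mtopology mtopology f"
    using assms(1,3) by (simp_all add: X)
  have f: "f \<in> M \<rightarrow> M" using continuous_map_funspace[OF cont] by simp
  have F: "F = graph_on mtopology f" by (simp add: F_def X)
  have fix_F: "fixed_set F = {x \<in> M. f x = x}" by (auto simp: F graph_on_def fixed_set_def)
  have K: "K = mtopology closure_of (M - fixed_set F)"
    unfolding K_def X using closure_of_complement[of mtopology "fixed_set F"] by simp
  have C: "chain_rel X (Restr F K) = metric_chain_rel mtopology d (Restr F K)"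
    unfolding X
    by (rule chain_rel_eq) (use comp f Metric_space_axioms in \<open>auto simp: compatible_metric_def F graph_on_def\<close>)
  have "F - Id \<subseteq> Restr F K"
  proof (rule subrelI)
    fix p q assume pq: "(p, q) \<in> F - Id"
    then have q: "q = f p" and "p \<in> M" by (auto simp: F graph_on_def)
    then have "p \<in> M - fixed_set F" using pq by (auto simp: fix_F)
    \<comment> \<open>The hypothesis on preimages enters here: the image of a non-fixed point is
      again non-fixed, so both entries of the pair lie in \<open>K\<close>.\<close>
    moreover from this have "q \<in> M - fixed_set F" using assms(5) f q by (auto simp: X)
    ultimately have "p \<in> K" "q \<in> K"
      using closure_of_subset[of "M - fixed_set F" mtopology] by (auto simp: K)
    then show "(p, q) \<in> Restr F K" using pq by simp
  qed
  then have mono: "metric_chain_rel mtopology d (F - Id) \<subseteq> metric_chain_rel mtopology d (Restr F K)"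
    by (rule metric_chain_rel_mono)
  have "W_rel X F \<subseteq> Id_on (fixed_set F) \<union> chain_rel X (Restr F K)"
  proof (rule subrelI)
    fix x y assume xy: "(x, y) \<in> W_rel X F"
    then have "x \<in> M" by (simp add: W_rel_def X)
    moreover have "x = y \<and> f x = x \<or> (x, y) \<in> metric_chain_rel mtopology d (F - Id)"
      using W_rel_cases[OF comp cont] xy unfolding F X .
    ultimately show "(x, y) \<in> Id_on (fixed_set F) \<union> chain_rel X (Restr F K)"
      using mono unfolding C by (auto simp: fix_F)
  qed
  moreover have "Id_on (fixed_set F) \<subseteq> W_rel X F"
    unfolding fix_F unfolding F X by (auto intro: fixed_in_W_rel[OF comp])
  moreover have "chain_rel X (Restr F K) \<subseteq> W_rel X F"
  proof (rule subrelI)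
    fix x y assume "(x, y) \<in> chain_rel X (Restr F K)"
    then have "(x, y) \<in> metric_chain_rel mtopology d
        (Restr (graph_on mtopology f) (mtopology closure_of (M - fixed_set F)))"
      unfolding C unfolding K F .
    then have "(x, y) \<in> W_rel mtopology (graph_on mtopology f)"
      by (rule chain_closure_nonfixed_in_W_rel[OF comp cont, rotated 2]) (auto simp: fix_F)
    then show "(x, y) \<in> W_rel X F" unfolding F X .
  qed
  ultimately have "W_rel X F = Id_on (fixed_set F) \<union> chain_rel X (Restr F K)" by blast
  then show ?thesis by (auto simp: fixed_set_def)
qed

end
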